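(* Let $\mathscr{H}_2$ be a separable real Hilbert space, let $K:\ell^2\to\mathscr{H}_2$ be a bounded linear operator, and let $I\subset\mathbb{Z}$ be finite. Assume that for every $u^{\diamond}\in\ell^2$ with $\operatorname{supp}(u^{\diamond})\subset I$ there exists $w\in\mathscr{H}_2$ such that $$P_IK^*w=P_I\operatorname{sign}(u^{\diamond})\qquad\text{and}\qquad\|P_{I^{\complement}}K^*w\|_{\ell^\infty}<1 .$$ Then $K$ has the null space property for the set $I$, i.e. for every $u\in\ker K$ with $u\neq0$, $$\|P_Iu\|_{\ell^1}<\|P_{I^{\complement}}u\|_{\ell^1}.$$
   Context: $\ell^2=\ell^2(\mathbb{Z},\mathbb{R})$ with standard basis $\{e_j\}_{j\in\mathbb{Z}}$; $\operatorname{supp}(u)=\{i\in\mathbb{Z}: u_i\neq 0\}$; $I^{\complement}=\mathbb{Z}\setminus I$. For $J\subset\mathbb{Z}$, $P_J:\ell^2\to\ell^2$ is the projection $P_Ju=\sum_{j\in J}u_je_j$. $\operatorname{sign}(u)$ is the componentwise sign of $u$, with $\operatorname{sign}(0)=0$. For $u\in\ell^2\setminus\ell^1$ one sets $\|u\|_{\ell^1}=\infty$. *)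

theory Defs
  imports "HOL-Analysis.Analysis"
begin

typedef ell2 = "{u :: int \<Rightarrow> real. (\<lambda>i. (u i)\<^sup>2) summable_on UNIV}"
  morphisms coord Abs_ell2
  by (rule exI[of _ "\<lambda>_. 0"]) simp

setup_lifting type_definition_ell2

lemma ell2_eqI: "(\<And>i. coord u i = coord v i) \<Longrightarrow> u = v"
  by (metis coord_inject ext)

lemma summable_coord_square: "(\<lambda>i. (coord u i)\<^sup>2) summable_on A"
  using coord[of u] by (intro summable_on_subset_banach[where A = UNIV and B = A]) simp_all

lemma summable_mult_square:
  fixes u v :: "int \<Rightarrow> real"
  assumes "(\<lambda>i. (u i)\<^sup>2) summable_on A" "(\<lambda>i. (v i)\<^sup>2) summable_on A"
  shows "(\<lambda>i. u i * v i) summable_on A"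
proof -
  have "(\<lambda>i. (u i)\<^sup>2 + (v i)\<^sup>2) summable_on A"
    using assms by (rule summable_on_add)
  then have "(\<lambda>i. norm (u i * v i)) summable_on A"
  proof (rule summable_on_comparison_test)
    fix i
    have "2 * \<bar>u i\<bar> * \<bar>v i\<bar> \<le> \<bar>u i\<bar>\<^sup>2 + \<bar>v i\<bar>\<^sup>2" by (rule sum_squares_bound)
    moreover have "0 \<le> \<bar>u i\<bar> * \<bar>v i\<bar>" by simp
    ultimately have "\<bar>u i\<bar> * \<bar>v i\<bar> \<le> \<bar>u i\<bar>\<^sup>2 + \<bar>v i\<bar>\<^sup>2" by linarith
    then show "norm (u i * v i) \<le> (u i)\<^sup>2 + (v i)\<^sup>2" by (simp only: real_norm_def abs_mult power2_abs)
  qed (rule norm_ge_zero)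
  then show ?thesis by (rule abs_summable_summable)
qed

lemma summable_coord_mult: "(\<lambda>i. coord u i * coord v i) summable_on A"
  by (intro summable_mult_square summable_coord_square)

instantiation ell2 :: real_vector
begin

lift_definition zero_ell2 :: ell2 is "\<lambda>_. 0" by simp

lift_definition plus_ell2 :: "ell2 \<Rightarrow> ell2 \<Rightarrow> ell2" is "\<lambda>u v i. u i + v i"
proof -
  fix u v :: "int \<Rightarrow> real"
  assume u: "(\<lambda>i. (u i)\<^sup>2) summable_on UNIV" and v: "(\<lambda>i. (v i)\<^sup>2) summable_on UNIV"
  have "(\<lambda>i. (u i)\<^sup>2 + (v i)\<^sup>2 + 2 * (u i * v i)) summable_on UNIV"
    by (intro summable_on_add summable_on_cmult_right summable_mult_square u v)
  then show "(\<lambda>i. (u i + v i)\<^sup>2) summable_on UNIV"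
    by (simp add: power2_sum mult.assoc)
qed

lift_definition uminus_ell2 :: "ell2 \<Rightarrow> ell2" is "\<lambda>u i. - u i" by simp

lift_definition scaleR_ell2 :: "real \<Rightarrow> ell2 \<Rightarrow> ell2" is "\<lambda>c u i. c * u i"
  by (simp add: power_mult_distrib summable_on_cmult_right)

definition minus_ell2 :: "ell2 \<Rightarrow> ell2 \<Rightarrow> ell2" where "minus_ell2 u v = u + - v"

instance
  by standard (rule ell2_eqI, simp add: minus_ell2_def plus_ell2.rep_eq uminus_ell2.rep_eq
      zero_ell2.rep_eq scaleR_ell2.rep_eq algebra_simps)+

end

lemma coord_simps [simp]:
  "coord 0 i = 0" "coord (u + v) i = coord u i + coord v i" "coord (- u) i = - coord u i"
  "coord (u - v) i = coord u i - coord v i" "coord (c *\<^sub>R u) i = c * coord u i"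
  by (simp_all only: diff_conv_add_uminus plus_ell2.rep_eq uminus_ell2.rep_eq zero_ell2.rep_eq
      scaleR_ell2.rep_eq)

instantiation ell2 :: real_inner
begin

definition inner_ell2 :: "ell2 \<Rightarrow> ell2 \<Rightarrow> real"
  where "inner_ell2 u v = (\<Sum>\<^sub>\<infinity>i. coord u i * coord v i)"

definition norm_ell2 :: "ell2 \<Rightarrow> real" where "norm_ell2 u = sqrt (inner u u)"

definition dist_ell2 :: "ell2 \<Rightarrow> ell2 \<Rightarrow> real" where "dist_ell2 u v = norm (u - v)"

definition sgn_ell2 :: "ell2 \<Rightarrow> ell2" where "sgn_ell2 u = inverse (norm u) *\<^sub>R u"

definition uniformity_ell2 :: "(ell2 \<times> ell2) filter"
  where "uniformity_ell2 = (INF e\<in>{0 <..}. principal {(x, y). dist x y < e})"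

definition open_ell2 :: "ell2 set \<Rightarrow> bool"
  where "open_ell2 U = (\<forall>x\<in>U. \<forall>\<^sub>F (x', y) in uniformity. x' = x \<longrightarrow> y \<in> U)"

instance
proof
  fix u v w :: ell2 and r :: real
  show "inner u v = inner v u" by (simp add: inner_ell2_def mult.commute)
  show "inner (u + v) w = inner u w + inner v w"
    by (simp add: inner_ell2_def distrib_right infsum_add summable_coord_mult)
  show "inner (r *\<^sub>R u) v = r * inner u v"
    by (simp add: inner_ell2_def mult.assoc infsum_cmult_right')
  show "0 \<le> inner u u" by (simp add: inner_ell2_def infsum_nonneg)
  show "inner u u = 0 \<longleftrightarrow> u = 0"
  proof
    assume "inner u u = 0"
    then have le: "(\<Sum>\<^sub>\<infinity>i. coord u i * coord u i) \<le> 0" by (simp only: inner_ell2_def order_refl)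
    have "coord u i * coord u i = 0" for i
      by (rule nonneg_infsum_le_0D[OF le summable_coord_mult]) simp_all
    then show "u = 0" by (intro ell2_eqI) simp
  qed (simp add: inner_ell2_def)
qed (rule norm_ell2_def dist_ell2_def sgn_ell2_def uniformity_ell2_def open_ell2_def)+

end

lift_definition unit_vec :: "int \<Rightarrow> ell2" is "\<lambda>j i. if i = j then 1 else 0"
  by (rule finite_nonzero_values_imp_summable_on) auto

definition supp :: "ell2 \<Rightarrow> int set" where "supp u = {i. coord u i \<noteq> 0}"

lift_definition proj :: "int set \<Rightarrow> ell2 \<Rightarrow> ell2" is "\<lambda>J u i. if i \<in> J then u i else 0"
  by (rule summable_on_comparison_test) auto

lemma coord_proj [simp]: "coord (proj J u) i = (if i \<in> J then coord u i else 0)"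
  by (simp add: proj.rep_eq)

lemma coord_unit_vec [simp]: "coord (unit_vec j) i = (if i = j then 1 else 0)"
  by (simp add: unit_vec.rep_eq)

lemma coord_sum: "coord (sum f F) i = (\<Sum>j\<in>F. coord (f j) i)"
  by (induction F rule: infinite_finite_induct) auto

text \<open>The coordinatewise definition of the projection agrees with the series
  \<open>P\<^sub>J u = \<Sum>j\<in>J. u\<^sub>j e\<^sub>j\<close>, convergent in the norm.\<close>

lemma proj_has_sum: "((\<lambda>j. coord u j *\<^sub>R unit_vec j) has_sum proj J u) J"
proof -
  define g where "g i = (coord u i)\<^sup>2" for i
  have g: "(g has_sum infsum g J) J"
    unfolding g_def by (intro has_sum_infsum summable_coord_square)
  have n: "dist (\<Sum>j\<in>F. coord u j *\<^sub>R unit_vec j) (proj J u) = sqrt (infsum g J - sum g F)"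
    if F: "finite F" "F \<subseteq> J" for F
  proof -
    have c: "coord ((\<Sum>j\<in>F. coord u j *\<^sub>R unit_vec j) - proj J u) i =
        (if i \<in> J - F then - coord u i else 0)" for i
      using F by (auto simp: coord_sum if_distrib cong: if_cong)
    have "inner ((\<Sum>j\<in>F. coord u j *\<^sub>R unit_vec j) - proj J u)
        ((\<Sum>j\<in>F. coord u j *\<^sub>R unit_vec j) - proj J u) = infsum g (J - F)"
      unfolding inner_ell2_def c g_def
      by (rule infsum_cong_neutral) (auto simp: power2_eq_square)
    also have "\<dots> = infsum g J - sum g F"
      using F has_sum_imp_summable[OF g] by (subst infsum_Diff) (simp_all add: summable_on_finite)
    finally show ?thesis by (simp add: dist_ell2_def norm_ell2_def)
  qed
  have "((\<lambda>F. infsum g J - sum g F) \<longlongrightarrow> infsum g J - infsum g J) (finite_subsets_at_top J)"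
    using g unfolding has_sum_def by (intro tendsto_diff tendsto_const)
  then have "((\<lambda>F. sqrt (infsum g J - sum g F)) \<longlongrightarrow> sqrt 0) (finite_subsets_at_top J)"
    by (intro tendsto_real_sqrt) simp
  moreover have "\<forall>\<^sub>F F in finite_subsets_at_top J.
      sqrt (infsum g J - sum g F) = dist (\<Sum>j\<in>F. coord u j *\<^sub>R unit_vec j) (proj J u)"
    by (intro eventually_finite_subsets_at_top_weakI) (simp add: n)
  ultimately have "((\<lambda>F. dist (\<Sum>j\<in>F. coord u j *\<^sub>R unit_vec j) (proj J u)) \<longlongrightarrow> 0)
      (finite_subsets_at_top J)"
    by (subst (asm) tendsto_cong) simp_all
  then show ?thesis
    unfolding has_sum_def by (subst tendsto_dist_iff)
qed

text \<open>The sign sequence is square summable only if the support is finite; for other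
  arguments the value of \<open>sign_vec\<close> is unspecified.  (The overloaded \<open>sgn\<close> on
  \<open>ell2\<close> is normalisation, not the componentwise sign.)\<close>

definition sign_vec :: "ell2 \<Rightarrow> ell2" where "sign_vec u = Abs_ell2 (\<lambda>i. sgn (coord u i))"

lemma coord_sign_vec:
  assumes "finite (supp u)"
  shows "coord (sign_vec u) i = sgn (coord u i)"
proof -
  have "(\<lambda>i. (sgn (coord u i))\<^sup>2) summable_on UNIV"
    by (rule finite_nonzero_values_imp_summable_on)
      (use assms in \<open>auto simp: supp_def sgn_eq_0_iff\<close>)
  then show ?thesis by (simp add: sign_vec_def Abs_ell2_inverse)
qed

text \<open>The library constant \<open>adjoint\<close> is a choice operator; for bounded operators on
  \<open>ell2\<close> the chosen map does satisfy the defining identity.\<close>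

lemma inner_unit_vec: "inner u (unit_vec i) = coord u i"
proof -
  have "inner u (unit_vec i) = (\<Sum>\<^sub>\<infinity>j\<in>{i}. coord u j)"
    unfolding inner_ell2_def by (rule infsum_cong_neutral) auto
  then show ?thesis by simp
qed

lemma adjoint_ell2:
  fixes K :: "ell2 \<Rightarrow> 'h :: real_inner"
  assumes K: "bounded_linear K"
  shows "inner (K u) w = inner u (adjoint K w)"
proof -
  interpret K: bounded_linear K by fact
  obtain B where B: "\<And>u. norm (K u) \<le> norm u * B" using K.bounded by blast
  have "\<exists>v. \<forall>u. inner (K u) w = inner u v" for w
  proof -
    define c where "c i = inner (K (unit_vec i)) w" for i
    have le: "(\<Sum>i\<in>F. (c i)\<^sup>2) \<le> (B * norm w)\<^sup>2" if F: "finite F" for F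
    proof -
      define s where "s = (\<Sum>i\<in>F. c i *\<^sub>R unit_vec i)"
      define S where "S = (\<Sum>i\<in>F. (c i)\<^sup>2)"
      have S0: "S \<ge> 0" unfolding S_def by (simp add: sum_nonneg)
      have cs: "coord s i = (if i \<in> F then c i else 0)" for i
        using F by (auto simp: s_def coord_sum if_distrib cong: if_cong)
      have "inner s s = (\<Sum>i\<in>F. c i * inner s (unit_vec i))"
        by (subst (2) s_def) (simp add: inner_sum_right)
      also have "\<dots> = S" by (simp add: S_def inner_unit_vec cs power2_eq_square)
      finally have ns: "norm s = sqrt S" by (simp add: norm_eq_sqrt_inner)
      have "S = inner (K s) w"
        by (simp add: S_def s_def K.sum K.scaleR inner_sum_left c_def power2_eq_square)
      also have "\<dots> \<le> norm (K s) * norm w" by (rule norm_cauchy_schwarz)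
      also have "\<dots> \<le> (norm s * B) * norm w" by (intro mult_right_mono B) simp
      finally have *: "S \<le> sqrt S * (B * norm w)" by (simp add: ns mult.assoc)
      have "S \<le> (B * norm w)\<^sup>2"
      proof (cases "S = 0")
        case False
        then have p: "sqrt S > 0" using S0 by simp
        have "sqrt S * sqrt S \<le> sqrt S * (B * norm w)" using * S0 by simp
        then have "sqrt S \<le> B * norm w" using p by (rule mult_left_le_imp_le)
        then have "(sqrt S)\<^sup>2 \<le> (B * norm w)\<^sup>2" using p by (intro power_mono) auto
        then show ?thesis using S0 by simp
      qed simp
      then show ?thesis by (simp add: S_def)
    qed
    have c: "(\<lambda>i. (c i)\<^sup>2) summable_on UNIV"
      by (rule nonneg_bdd_above_summable_on) (auto intro!: bdd_aboveI2 le)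
    define v where "v = Abs_ell2 c"
    have v: "coord v i = c i" for i using c by (simp add: v_def Abs_ell2_inverse)
    have "inner (K u) w = inner u v" for u
    proof -
      have bl: "bounded_linear (\<lambda>x. inner (K x) w)"
        using bounded_linear_compose[OF bounded_linear_inner_left K] .
      have u: "proj UNIV u = u" by (rule ell2_eqI) simp
      have "((\<lambda>i. inner (K (coord u i *\<^sub>R unit_vec i)) w) has_sum inner (K u) w) UNIV"
        using has_sum_bounded_linear[OF bl proj_has_sum[of u UNIV]] by (simp add: u o_def)
      then have "((\<lambda>i. coord u i * coord v i) has_sum inner (K u) w) UNIV"
        by (simp add: K.scaleR v c_def)
      then show ?thesis unfolding inner_ell2_def by (simp add: infsumI)
    qed
    then show ?thesis by blast
  qed
  then obtain f where "\<forall>u w. inner (K u) w = inner u (f w)" by metis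
  then have "\<forall>u w. inner (K u) w = inner u (adjoint K w)"
    unfolding adjoint_def by (rule someI[where P = "\<lambda>f'. \<forall>u w. inner (K u) w = inner u (f' w)"])
  then show ?thesis by blast
qed

text \<open>Extended nonnegative values: the sum is \<open>\<infinity>\<close> when \<open>u\<close> is not
  absolutely summable.\<close>

definition l1_norm :: "ell2 \<Rightarrow> ennreal" where "l1_norm u = (\<Sum>\<^sub>\<infinity>i. ennreal \<bar>coord u i\<bar>)"

definition linf_norm :: "ell2 \<Rightarrow> ennreal" where "linf_norm u = (SUP i. ennreal \<bar>coord u i\<bar>)"

definition null_space_property :: "(ell2 \<Rightarrow> 'h::real_inner) \<Rightarrow> int set \<Rightarrow> bool"
  where "null_space_property K I \<longleftrightarrow>
    (\<forall>u. K u = 0 \<and> u \<noteq> 0 \<longrightarrow> l1_norm (proj I u) < l1_norm (proj (- I) u))"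

end

theory Submission
  imports Defs
begin

text \<open>The inequality is a duality estimate.  Given \<open>u \<noteq> 0\<close> in the kernel of \<open>K\<close>, take \<open>w\<close> for the
  finitely supported sequence \<open>P\<^sub>I u\<close> and put \<open>v = K\<^sup>* w\<close>.  On \<open>I\<close> the sequence \<open>v\<close> is the sign
  of \<open>u\<close>, so testing \<open>0 = \<langle>K u, w\<rangle> = \<langle>u, v\<rangle>\<close> coordinatewise gives
  \<open>\<parallel>P\<^sub>I u\<parallel>\<^sub>1 = - (\<Sum>i\<notin>I. u\<^sub>i v\<^sub>i)\<close>.  Off \<open>I\<close> the entries of \<open>v\<close> are bounded by some \<open>c < 1\<close>, whence
  \<open>\<parallel>P\<^sub>I u\<parallel>\<^sub>1 \<le> c \<parallel>P\<^bsub>-I\<^esub> u\<parallel>\<^sub>1\<close> as soon as the right-hand norm is finite; if it is infinite, finiteness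
  of \<open>I\<close> already settles the claim.  The estimate is strict because \<open>P\<^bsub>-I\<^esub> u\<close> cannot vanish:
  otherwise \<open>P\<^sub>I u\<close> would vanish as well, by the same estimate, and \<open>u\<close> would be zero.  The estimate is
  \<open>dual_certificate_bound\<close>; the other lemmas pass between the extended norms and real numbers.\<close>

lemma l1_norm_proj: "l1_norm (proj J u) = (\<Sum>\<^sub>\<infinity>i\<in>J. ennreal \<bar>coord u i\<bar>)"
  unfolding l1_norm_def by (rule infsum_cong_neutral) auto

lemma l1_norm_proj_summable:
  assumes "(\<lambda>i. \<bar>coord u i\<bar>) summable_on J"
  shows "l1_norm (proj J u) = ennreal (\<Sum>\<^sub>\<infinity>i\<in>J. \<bar>coord u i\<bar>)"
proof -
  have "((\<lambda>F. ennreal (\<Sum>i\<in>F. \<bar>coord u i\<bar>)) \<longlongrightarrow> ennreal (\<Sum>\<^sub>\<infinity>i\<in>J. \<bar>coord u i\<bar>))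
      (finite_subsets_at_top J)"
    using has_sum_infsum[OF assms] unfolding has_sum_def by (rule tendsto_ennrealI)
  moreover have "(\<lambda>F. ennreal (\<Sum>i\<in>F. \<bar>coord u i\<bar>)) = sum (\<lambda>i. ennreal \<bar>coord u i\<bar>)"
    by (rule ext) (rule sum_ennreal[symmetric], rule abs_ge_zero)
  ultimately have "((\<lambda>i. ennreal \<bar>coord u i\<bar>) has_sum ennreal (\<Sum>\<^sub>\<infinity>i\<in>J. \<bar>coord u i\<bar>)) J"
    by (simp only: has_sum_def)
  then show ?thesis by (simp add: l1_norm_proj infsumI)
qed

lemma summable_if_l1_norm_finite:
  assumes "l1_norm (proj J u) < \<infinity>"
  shows "(\<lambda>i. \<bar>coord u i\<bar>) summable_on J"
proof (rule nonneg_bdd_above_summable_on)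
  have "(\<Sum>i\<in>F. \<bar>coord u i\<bar>) \<le> enn2real (l1_norm (proj J u))" if "F \<subseteq> J" "finite F" for F
  proof -
    have "ennreal (\<Sum>i\<in>F. \<bar>coord u i\<bar>) = (\<Sum>i\<in>F. ennreal \<bar>coord u i\<bar>)" by simp
    also have "\<dots> = (\<Sum>\<^sub>\<infinity>i\<in>F. ennreal \<bar>coord u i\<bar>)" using that by simp
    also have "\<dots> \<le> l1_norm (proj J u)"
      unfolding l1_norm_proj using that
      by (intro infsum_mono_neutral nonneg_summable_on_complete) auto
    finally show ?thesis
      using assms by (cases "l1_norm (proj J u)") (simp_all del: sum_ennreal)
  qed
  then show "bdd_above (sum (\<lambda>i. \<bar>coord u i\<bar>) ` {F. F \<subseteq> J \<and> finite F})"
    by (intro bdd_aboveI2) auto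
qed simp

text \<open>A strict bound on the supremum norm leaves a gap below 1 that is uniform in the index.\<close>

lemma linf_norm_less_one_bound:
  assumes "linf_norm (proj J v) < 1"
  obtains c where "0 \<le> c" "c < 1" "\<And>i. i \<in> J \<Longrightarrow> \<bar>coord v i\<bar> \<le> c"
proof
  let ?N = "linf_norm (proj J v)"
  have N: "ennreal (enn2real ?N) = ?N"
    using assms by (cases ?N) simp_all
  show "0 \<le> enn2real ?N" by simp
  show "enn2real ?N < 1" using assms by (cases ?N) simp_all
  show "\<bar>coord v i\<bar> \<le> enn2real ?N" if "i \<in> J" for i
  proof -
    have "ennreal \<bar>coord v i\<bar> = ennreal \<bar>coord (proj J v) i\<bar>" using that by simp
    also have "\<dots> \<le> ennreal (enn2real ?N)" unfolding N by (subst linf_norm_def) (rule SUP_upper, simp)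
    finally show ?thesis by simp
  qed
qed

lemma inner_split:
  "inner u v = (\<Sum>\<^sub>\<infinity>i\<in>I. coord u i * coord v i) + (\<Sum>\<^sub>\<infinity>i\<in>-I. coord u i * coord v i)"
  unfolding inner_ell2_def
  by (subst infsum_Un_disjoint[symmetric]) (simp_all add: summable_coord_mult)

text \<open>A vector \<open>v\<close> as below is a dual certificate.  Orthogonality cancels the pairing of \<open>u\<close> and
  \<open>v\<close> on \<open>I\<close>, where it is the \<open>\<ell>\<^sup>1\<close> norm of \<open>u\<close>, against the pairing off \<open>I\<close>, to which Hoelder's
  inequality applies.\<close>

lemma dual_certificate_bound:
  assumes "inner u v = 0"
    and sgn: "\<And>i. i \<in> I \<Longrightarrow> coord v i = sgn (coord u i)"
    and c: "\<And>i. i \<in> -I \<Longrightarrow> \<bar>coord v i\<bar> \<le> c"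
    and u: "(\<lambda>i. \<bar>coord u i\<bar>) summable_on -I"
  shows "(\<Sum>\<^sub>\<infinity>i\<in>I. \<bar>coord u i\<bar>) \<le> c * (\<Sum>\<^sub>\<infinity>i\<in>-I. \<bar>coord u i\<bar>)"
proof -
  have "(\<Sum>\<^sub>\<infinity>i\<in>I. \<bar>coord u i\<bar>) = (\<Sum>\<^sub>\<infinity>i\<in>I. coord u i * coord v i)"
    by (rule infsum_cong) (simp add: sgn abs_sgn)
  also have "\<dots> = (\<Sum>\<^sub>\<infinity>i\<in>-I. - (coord u i * coord v i))"
    using \<open>inner u v = 0\<close> inner_split[of u v I] by (simp add: infsum_uminus)
  also have "\<dots> \<le> (\<Sum>\<^sub>\<infinity>i\<in>-I. c * \<bar>coord u i\<bar>)"
  proof (rule infsum_mono)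
    fix i assume "i \<in> -I"
    have "- (coord u i * coord v i) \<le> \<bar>coord v i\<bar> * \<bar>coord u i\<bar>"
      by (metis abs_ge_minus_self abs_mult mult.commute)
    also have "\<dots> \<le> c * \<bar>coord u i\<bar>" using c[OF \<open>i \<in> -I\<close>] by (intro mult_right_mono) auto
    finally show "- (coord u i * coord v i) \<le> c * \<bar>coord u i\<bar>" .
  qed (use u in \<open>simp_all add: summable_coord_mult summable_on_uminus summable_on_cmult_right\<close>)
  also have "\<dots> = c * (\<Sum>\<^sub>\<infinity>i\<in>-I. \<bar>coord u i\<bar>)" by (rule infsum_cmult_right')
  finally show ?thesis .
qed

lemma infsum_abs_coord_eq_0:
  assumes "(\<lambda>i. \<bar>coord u i\<bar>) summable_on J" "(\<Sum>\<^sub>\<infinity>i\<in>J. \<bar>coord u i\<bar>) \<le> 0" "i \<in> J"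
  shows "coord u i = 0"
  using nonneg_infsum_le_0D[OF assms(2,1) _ assms(3)] by simp

theorem proposition5p3:
  fixes K :: "ell2 \<Rightarrow> 'h :: {real_inner, complete_space}"
    and I :: "int set"
  assumes "separable_space (euclidean :: 'h topology)"
    and "bounded_linear K"
    and "finite I"
    and "\<And>u. supp u \<subseteq> I \<Longrightarrow>
           \<exists>w. proj I (adjoint K w) = proj I (sign_vec u) \<and>
               linf_norm (proj (- I) (adjoint K w)) < 1"
  shows "null_space_property K I"
  unfolding null_space_property_def
proof (intro allI impI, elim conjE)
  fix u assume Ku: "K u = 0" and "u \<noteq> 0"
  define a where "a = (\<Sum>\<^sub>\<infinity>i\<in>I. \<bar>coord u i\<bar>)"
  define b where "b = (\<Sum>\<^sub>\<infinity>i\<in>-I. \<bar>coord u i\<bar>)"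
  have sI: "(\<lambda>i. \<bar>coord u i\<bar>) summable_on I" using \<open>finite I\<close> by simp
  have a: "l1_norm (proj I u) = ennreal a"
    unfolding a_def by (rule l1_norm_proj_summable[OF sI])
  show "l1_norm (proj I u) < l1_norm (proj (- I) u)"
  proof (cases "l1_norm (proj (- I) u) < \<infinity>")
    case True
    then have sC: "(\<lambda>i. \<bar>coord u i\<bar>) summable_on -I" by (rule summable_if_l1_norm_finite)
    have supp: "supp (proj I u) \<subseteq> I" by (auto simp: supp_def split: if_splits)
    obtain w where w: "proj I (adjoint K w) = proj I (sign_vec (proj I u))"
        "linf_norm (proj (- I) (adjoint K w)) < 1"
      using assms(4)[OF supp] by blast
    obtain c where c: "0 \<le> c" "c < 1" "\<And>i. i \<in> -I \<Longrightarrow> \<bar>coord (adjoint K w) i\<bar> \<le> c"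
      using linf_norm_less_one_bound[OF w(2)] by blast
    have "coord (adjoint K w) i = sgn (coord u i)" if "i \<in> I" for i
    proof -
      have "coord (adjoint K w) i = coord (proj I (adjoint K w)) i" using that by simp
      also have "\<dots> = coord (sign_vec (proj I u)) i" using that by (simp add: w(1))
      also have "\<dots> = sgn (coord u i)"
        using that finite_subset[OF supp \<open>finite I\<close>] by (simp add: coord_sign_vec)
      finally show ?thesis .
    qed
    moreover have "inner u (adjoint K w) = 0"
      using adjoint_ell2[OF assms(2), of u w] Ku by simp
    ultimately have le: "a \<le> c * b"
      unfolding a_def b_def using c(3) sC by (intro dual_certificate_bound) blast+
    have "0 < b"
    proof (rule ccontr)
      assume "\<not> 0 < b"
      then have b: "b \<le> 0" by simp
      then have "a \<le> 0" using le mult_nonneg_nonpos[OF c(1) b] by linarith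
      then have "coord u i = 0" for i
        using infsum_abs_coord_eq_0[OF sI] infsum_abs_coord_eq_0[OF sC] b
        unfolding a_def b_def by blast
      then have "u = 0" by (intro ell2_eqI) simp
      with \<open>u \<noteq> 0\<close> show False ..
    qed
    then have "c * b < b" using c(2) by simp
    with le have "ennreal a < ennreal b" using \<open>0 < b\<close> by (intro ennreal_lessI) linarith+
    then show ?thesis by (simp only: a l1_norm_proj_summable[OF sC] b_def)
  next
    case False
    then have "l1_norm (proj (- I) u) = \<infinity>" by (cases "l1_norm (proj (- I) u)") simp_all
    then show ?thesis by (simp add: a)
  qed
qed

end
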